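(* Let $m\ge 1$ be a fixed integer and, for $n\ge 2$, let $D_n$ be the depth of a node labeled $n$ in an $m$-ary recursive tree. Then $$d_{TV}\Big(\mathcal L(D_n),\ \mathcal L\Big(\mathrm{Poi}\Big(1+\mathcal H^{(1)}_{n-2}\Big(\frac1m\Big)\Big)\Big)\Big)\ \le\ \frac{1+\Psi\big(1,1+\frac1m\big)}{1+\mathcal H^{(1)}_{n-2}\big(\frac1m\big)} ,$$ and the right-hand side is $O\big(\frac{1}{\ln (n)}\big)$ as $n\to\infty$.
   Context: Fix an integer $m\ge 1$. The $m$-ary recursive tree grows as follows. It starts as a single root node labeled $1$. For each $n\ge 1$, given the tree with highest label $n$ (which has $m(n-1)+1$ nodes), one of its nodes is selected uniformly at random, and $m$ new nodes, all receiving the label $n+1$, are attached as children of the selected node. The depth of a node is its edge distance to the root; all nodes labeled $n$ have the same depth, denoted $D_n$. For integer $r\ge1$ and real $y>0$, $\mathcal H^{(r)}_n(y)=\sum_{i=1}^n\frac{1}{(i+y)^r}$ (with $\mathcal H^{(r)}_0(y)=0$). $\Psi(1,x)=\frac{d^2}{dx^2}\ln\Gamma(x)$ is the trigamma function. $\mathcal L(X)$ is the law of $X$, $\mathrm{Poi}(\lambda)$ is a Poisson random variable with mean $\lambda$, and for probability measures $\mathbb Q_1,\mathbb Q_2$ on $\mathbb N\cup\{0\}$, $d_{TV}(\mathbb Q_1,\mathbb Q_2)=\sup_{A\subseteq\mathbb N\cup\{0\}}|\mathbb Q_1(A)-\mathbb Q_2(A)|$. *)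

theory Defs
  imports "HOL-Probability.Probability" "HOL-Library.Landau_Symbols"
begin

text \<open>
  A node is a pair (label, index): the root is (1, 0) and the \<open>m\<close> nodes that receive the
  label \<open>l \<ge> 2\<close> are (l, 0), ..., (l, m - 1).
\<close>

type_synonym node = "nat \<times> nat"

abbreviation label :: "node \<Rightarrow> nat" where "label \<equiv> fst"

record tree =
  nodes :: "node set"
  edges :: "(node \<times> node) set"  \<comment> \<open>pairs (parent, child)\<close>

definition root_node :: node where "root_node = (1, 0)"

definition root_tree :: tree where
  "root_tree = \<lparr>nodes = {root_node}, edges = {}\<rparr>"

definition attach :: "nat \<Rightarrow> nat \<Rightarrow> node \<Rightarrow> tree \<Rightarrow> tree" where
  "attach m l v t =
     \<lparr>nodes = nodes t \<union> {l} \<times> {..<m}, edges = edges t \<union> {v} \<times> ({l} \<times> {..<m})\<rparr>"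

text \<open>
  \<open>recursive_tree m k\<close> is the law of the tree after \<open>k\<close> attachments, so its highest label
  is \<open>k + 1\<close>.
\<close>

primrec recursive_tree :: "nat \<Rightarrow> nat \<Rightarrow> tree pmf" where
  "recursive_tree m 0 = return_pmf root_tree"
| "recursive_tree m (Suc k) =
     bind_pmf (recursive_tree m k) (\<lambda>t.
     bind_pmf (pmf_of_set (nodes t)) (\<lambda>v.
     return_pmf (attach m (k + 2) v t)))"

definition edge_distance :: "tree \<Rightarrow> node \<Rightarrow> node \<Rightarrow> nat" where
  "edge_distance t u v = (LEAST d. (u, v) \<in> (edges t \<union> (edges t)\<inverse>) ^^ d)"

definition depth :: "tree \<Rightarrow> node \<Rightarrow> nat" where
  "depth t v = edge_distance t root_node v"

text \<open>The common depth of all nodes labeled \<open>l\<close>; see \<open>depths_singleton\<close> below.\<close>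

definition label_depth :: "nat \<Rightarrow> tree \<Rightarrow> nat" where
  "label_depth l t = the_elem (depth t ` {v \<in> nodes t. label v = l})"

text \<open>The law of \<open>D\<^sub>n\<close>, for \<open>n \<ge> 1\<close>.\<close>

definition D_law :: "nat \<Rightarrow> nat \<Rightarrow> nat pmf" where
  "D_law m n = map_pmf (label_depth n) (recursive_tree m (n - 1))"

definition shifted_harm :: "nat \<Rightarrow> nat \<Rightarrow> real \<Rightarrow> real" where
  "shifted_harm r n y = (\<Sum>i=1..n. 1 / (real i + y) ^ r)"

definition dTV :: "nat pmf \<Rightarrow> nat pmf \<Rightarrow> real" where
  "dTV p q = (SUP A. \<bar>measure_pmf.prob p A - measure_pmf.prob q A\<bar>)"

lemma recursive_tree_depth:
  assumes "t \<in> set_pmf (recursive_tree m k)"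
  shows "nodes t = insert root_node ({2..k + 1} \<times> {..<m}) \<and> edges t \<subseteq> nodes t \<times> nodes t \<and>
    (\<exists>h. h root_node = 0 \<and> (\<forall>(u, v) \<in> edges t. h v = Suc (h u)) \<and>
         (\<forall>v \<in> nodes t. (root_node, v) \<in> edges t ^^ h v) \<and>
         (\<forall>u \<in> nodes t. \<forall>v \<in> nodes t. label u = label v \<longrightarrow> h u = h v))"
  using assms
proof (induction k arbitrary: t)
  case 0
  then show ?case by (auto simp: root_tree_def intro: exI[of _ "\<lambda>_. 0"])
next
  case (Suc k)
  from Suc.prems obtain s v where s: "s \<in> set_pmf (recursive_tree m k)"
    and v: "v \<in> set_pmf (pmf_of_set (nodes s))" and t: "t = attach m (k + 2) v s"
    by auto
  from Suc.IH[OF s] obtain h where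
    N: "nodes s = insert root_node ({2..k + 1} \<times> {..<m})" and E: "edges s \<subseteq> nodes s \<times> nodes s" and
    h: "h root_node = 0" "\<And>u w. (u, w) \<in> edges s \<Longrightarrow> h w = Suc (h u)"
      "\<And>w. w \<in> nodes s \<Longrightarrow> (root_node, w) \<in> edges s ^^ h w"
      "\<And>u w. u \<in> nodes s \<Longrightarrow> w \<in> nodes s \<Longrightarrow> label u = label w \<Longrightarrow> h u = h w"
    by blast
  have vs: "v \<in> nodes s" using v N by (subst (asm) set_pmf_of_set) auto
  have lab: "label w < k + 2" if "w \<in> nodes s" for w
    using that unfolding N by (auto simp: root_node_def)
  define g where "g = (\<lambda>w. if label w = k + 2 then Suc (h v) else h w)"
  have g_old: "g w = h w" if "w \<in> nodes s" for w
    using lab[OF that] by (auto simp: g_def)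
  have Nt: "nodes t = nodes s \<union> {k + 2} \<times> {..<m}"
    and Et: "edges t = edges s \<union> {v} \<times> ({k + 2} \<times> {..<m})"
    by (simp_all add: t attach_def)
  have sub: "edges s ^^ d \<subseteq> edges t ^^ d" for d
    by (induction d) (auto simp: Et)
  have reach: "(root_node, w) \<in> edges t ^^ g w" if w: "w \<in> nodes t" for w
  proof (cases "w \<in> nodes s")
    case True
    then show ?thesis using h(3)[OF True] g_old[OF True] sub by auto
  next
    case False
    with w have "w \<in> {k + 2} \<times> {..<m}" by (auto simp: Nt)
    then have "g w = Suc (h v)" "(v, w) \<in> edges t" by (auto simp: g_def Et)
    then show ?thesis using h(3)[OF vs] sub by auto
  qed
  have step: "g w = Suc (g u)" if "(u, w) \<in> edges t" for u w
  proof (cases "(u, w) \<in> edges s")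
    case True
    then have "u \<in> nodes s" "w \<in> nodes s" using E by auto
    then show ?thesis using h(2)[OF True] g_old by metis
  next
    case False
    then have "u = v" "label w = k + 2" using that by (auto simp: Et)
    then show ?thesis using g_old[OF vs] by (simp add: g_def)
  qed
  have same: "g u = g w" if "u \<in> nodes t" "w \<in> nodes t" "label u = label w" for u w
  proof (cases "label u = k + 2")
    case True
    then show ?thesis using that(3) by (simp add: g_def)
  next
    case False
    then have "u \<in> nodes s" "w \<in> nodes s" using that by (auto simp: Nt)
    then show ?thesis using h(4)[of u w] that(3) g_old by simp
  qed
  have g0: "g root_node = 0" using g_old[of root_node] h(1) by (simp add: N)
  have "nodes t = insert root_node ({2..Suc k + 1} \<times> {..<m})"
    unfolding Nt N by auto
  moreover have "edges t \<subseteq> nodes t \<times> nodes t" using E vs by (auto simp: Et Nt)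
  ultimately show ?case using reach step same g0 by (intro conjI exI[of _ g]) blast+
qed

lemma depths_singleton:
  assumes "t \<in> set_pmf (recursive_tree m k)" "m \<ge> 1" "1 \<le> l" "l \<le> k + 1"
  shows "depth t ` {v \<in> nodes t. label v = l} = {label_depth l t}"
proof -
  from recursive_tree_depth[OF assms(1)] obtain h where
    N: "nodes t = insert root_node ({2..k + 1} \<times> {..<m})" and
    h: "h root_node = (0::nat)" "\<And>u w. (u, w) \<in> edges t \<Longrightarrow> h w = Suc (h u)"
      "\<And>w. w \<in> nodes t \<Longrightarrow> (root_node, w) \<in> edges t ^^ h w"
      "\<And>u w. u \<in> nodes t \<Longrightarrow> w \<in> nodes t \<Longrightarrow> label u = label w \<Longrightarrow> h u = h w"
    by blast
  have lower: "h w \<le> d" if "(root_node, w) \<in> (edges t \<union> (edges t)\<inverse>) ^^ d" for w d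
    using that
  proof (induction d arbitrary: w)
    case (Suc d)
    then obtain u where u: "(root_node, u) \<in> (edges t \<union> (edges t)\<inverse>) ^^ d"
      "(u, w) \<in> edges t \<or> (w, u) \<in> edges t" by auto
    then show ?case using Suc.IH[OF u(1)] h(2)[of u w] h(2)[of w u] by auto
  qed (auto simp: h(1))
  have d: "depth t w = h w" if "w \<in> nodes t" for w
    unfolding depth_def edge_distance_def
  proof (rule Least_equality)
    have "edges t ^^ d \<subseteq> (edges t \<union> (edges t)\<inverse>) ^^ d" for d
      by (induction d) auto
    then show "(root_node, w) \<in> (edges t \<union> (edges t)\<inverse>) ^^ h w"
      using h(3)[OF that] by blast
  qed (rule lower)
  have "(if l = 1 then root_node else (l, 0)) \<in> {v \<in> nodes t. label v = l}"
    using assms N by (auto simp: root_node_def)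
  then obtain w where w: "w \<in> nodes t" "label w = l" by blast
  have const: "depth t v = h w" if "v \<in> {v \<in> nodes t. label v = l}" for v
    using that d[of v] h(4)[of v w] w by simp
  have "depth t ` {v \<in> nodes t. label v = l} = (\<lambda>_. h w) ` {v \<in> nodes t. label v = l}"
    using const by (rule image_cong[OF refl])
  also have "\<dots> = {h w}"
    using w by blast
  finally have "depth t ` {v \<in> nodes t. label v = l} = {h w}" .
  then show ?thesis by (simp add: label_depth_def)
qed

end

theory Submission
  imports Defs
begin

text \<open>
  Averaging over a uniform node shows that each attachment adds an independent Bernoulli variable
  to the depth of a uniform node: \<open>D\<^sub>n\<close> is distributed as \<open>1 + \<Sum>i=1..n-2. X\<^sub>i\<close> with
  \<open>X\<^sub>i\<close> Bernoulli of parameter \<open>1 / (i + 1/m)\<close>. The Chen-Stein method bounds the distance of a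
  sum of independent Bernoulli variables to the Poisson law of the same mean \<open>\<mu>\<close> by
  \<open>\<mu>\<inverse> \<Sum> p\<^sub>i\<^sup>2\<close>; the factor \<open>\<mu>\<inverse>\<close> is the Barbour-Hall bound on the increments of
  the solution of the Stein equation, and \<open>\<Sum> p\<^sub>i\<^sup>2\<close> is one plus a partial sum of the trigamma series.
\<close>

section \<open>Depths under attachment, and node counts\<close>

text \<open>Heights rise by exactly one along each edge, so an undirected walk of length
  \<open>d\<close> from the root ends at height at most \<open>d\<close>, and a directed one at
  height exactly \<open>d\<close>. Depths can then be read off directed paths alone.\<close>

lemma recursive_tree_height:
  assumes "t \<in> set_pmf (recursive_tree m k)"
  shows "depth t root_node = 0"
    and "\<And>w d. (root_node, w) \<in> edges t ^^ d \<Longrightarrow> depth t w = d"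
    and "\<And>w. w \<in> nodes t \<Longrightarrow> (root_node, w) \<in> edges t ^^ depth t w"
proof -
  from recursive_tree_depth[OF assms] obtain h where
    h: "h root_node = (0::nat)" "\<And>u w. (u, w) \<in> edges t \<Longrightarrow> h w = Suc (h u)"
      "\<And>w. w \<in> nodes t \<Longrightarrow> (root_node, w) \<in> edges t ^^ h w"
    by blast
  have lower: "h w \<le> d" if "(root_node, w) \<in> (edges t \<union> (edges t)\<inverse>) ^^ d" for w d
    using that
  proof (induction d arbitrary: w)
    case (Suc d)
    then obtain u where u: "(root_node, u) \<in> (edges t \<union> (edges t)\<inverse>) ^^ d"
      "(u, w) \<in> edges t \<or> (w, u) \<in> edges t" by auto
    then show ?case using Suc.IH[OF u(1)] h(2)[of u w] h(2)[of w u] by auto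
  qed (auto simp: h(1))
  have path: "h w = d" if "(root_node, w) \<in> edges t ^^ d" for w d
    using that by (induction d arbitrary: w) (auto simp: h)
  have sub: "edges t ^^ d \<subseteq> (edges t \<union> (edges t)\<inverse>) ^^ d" for d
    by (induction d) auto
  show *: "depth t w = d" if "(root_node, w) \<in> edges t ^^ d" for w d
    unfolding depth_def edge_distance_def
  proof (rule Least_equality)
    show "(root_node, w) \<in> (edges t \<union> (edges t)\<inverse>) ^^ d"
      using that sub by blast
  qed (use path[OF that] lower in blast)
  show "depth t root_node = 0"
    by (rule *) simp
  show "(root_node, w) \<in> edges t ^^ depth t w" if "w \<in> nodes t" for w
    using h(3)[OF that] * by metis
qed

text \<open>Directed paths survive an attachment, and the length of any one directed path from the
  root determines the depth of its end.\<close>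

lemma depth_attach:
  assumes s: "s \<in> set_pmf (recursive_tree m k)" and v: "v \<in> nodes s"
  defines "t \<equiv> attach m (k + 2) v s"
  shows "w \<in> nodes s \<Longrightarrow> depth t w = depth s w"
    and "i < m \<Longrightarrow> depth t (k + 2, i) = Suc (depth s v)"
proof -
  have ns: "nodes s = insert root_node ({2..k + 1} \<times> {..<m})"
    using recursive_tree_depth[OF s] by simp
  then have "v \<in> set_pmf (pmf_of_set (nodes s))"
    using v by (subst set_pmf_of_set) auto
  then have t: "t \<in> set_pmf (recursive_tree m (Suc k))"
    using s by (auto simp: t_def)
  have sub: "edges s ^^ d \<subseteq> edges t ^^ d" for d
    by (induction d) (auto simp: t_def attach_def)
  show old: "depth t w = depth s w" if "w \<in> nodes s" for w
    using recursive_tree_height(2)[OF t] recursive_tree_height(3)[OF s that] sub by blast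
  show "depth t (k + 2, i) = Suc (depth s v)" if "i < m"
  proof (rule recursive_tree_height(2)[OF t])
    have "(v, (k + 2, i)) \<in> edges t"
      using that by (auto simp: t_def attach_def)
    then show "(root_node, (k + 2, i)) \<in> edges t ^^ Suc (depth s v)"
      using recursive_tree_height(3)[OF s v] sub by auto
  qed
qed

lemma card_nodes:
  assumes "s \<in> set_pmf (recursive_tree m k)"
  shows "finite (nodes s)" "nodes s \<noteq> {}" "card (nodes s) = m * k + 1"
    "nodes s \<inter> {k + 2} \<times> {..<m} = {}"
proof -
  have ns: "nodes s = insert root_node ({2..k + 1} \<times> {..<m})"
    using recursive_tree_depth[OF assms] by simp
  then show "finite (nodes s)" "nodes s \<noteq> {}"
    by simp_all
  show "nodes s \<inter> {k + 2} \<times> {..<m} = {}"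
    unfolding ns root_node_def by auto
  have "root_node \<notin> {2..k + 1} \<times> {..<m}"
    by (simp add: root_node_def)
  then show "card (nodes s) = m * k + 1"
    unfolding ns by (simp add: card_cartesian_product)
qed

lemma finite_set_recursive_tree: "finite (set_pmf (recursive_tree m k))"
proof (induction k)
  case (Suc k)
  then show ?case
    using card_nodes(1,2) by (auto simp: set_pmf_of_set)
qed simp

section \<open>Sums of independent Bernoulli variables\<close>

text \<open>
  The expectation of \<open>f\<close> at a sum of independent Bernoulli variables with parameters \<open>ps\<close>.
\<close>

primrec bernoulli_sum_expectation :: "real list \<Rightarrow> (nat \<Rightarrow> real) \<Rightarrow> real" where
  "bernoulli_sum_expectation [] f = f 0"
| "bernoulli_sum_expectation (p # ps) f =
     (1 - p) * bernoulli_sum_expectation ps f + p * bernoulli_sum_expectation ps (\<lambda>j. f (Suc j))"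

lemma bernoulli_sum_expectation_linear:
  "bernoulli_sum_expectation ps (\<lambda>j. a * f j + b * g j) =
     a * bernoulli_sum_expectation ps f + b * bernoulli_sum_expectation ps g"
proof (induction ps arbitrary: f g)
  case (Cons p ps)
  show ?case
    unfolding bernoulli_sum_expectation.simps Cons.IH by (simp add: algebra_simps)
qed simp

lemma bernoulli_sum_expectation_const [simp]: "bernoulli_sum_expectation ps (\<lambda>_. c) = c"
  by (induction ps) (simp_all add: algebra_simps)

lemma abs_convex_combination_le:
  fixes p x y c d :: real
  assumes "0 \<le> p" "p \<le> 1" "\<bar>x\<bar> \<le> c" "\<bar>y\<bar> \<le> c"
  shows "\<bar>(1 - p) * x + p * y\<bar> \<le> c"
proof -
  have "\<bar>(1 - p) * x + p * y\<bar> \<le> (1 - p) * \<bar>x\<bar> + p * \<bar>y\<bar>"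
    using assms(1,2) abs_triangle_ineq[of "(1 - p) * x" "p * y"] by (simp add: abs_mult)
  also have "\<dots> \<le> (1 - p) * c + p * c"
    using assms by (intro add_mono mult_left_mono) auto
  finally show ?thesis by (simp add: algebra_simps)
qed

lemma bernoulli_sum_expectation_bound:
  assumes "\<And>p. p \<in> set ps \<Longrightarrow> 0 \<le> p \<and> p \<le> 1" "\<And>j. \<bar>f j\<bar> \<le> c"
  shows "\<bar>bernoulli_sum_expectation ps f\<bar> \<le> c"
  using assms
proof (induction ps arbitrary: f)
  case (Cons p ps)
  then show ?case
    unfolding bernoulli_sum_expectation.simps
    by (intro abs_convex_combination_le Cons.IH) auto
qed simp

text \<open>Splitting off the first variable reproduces the expression for \<open>g\<close> with
  weight \<open>1 - p\<close> and for its shift with weight \<open>p\<close>; the leftover is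
  \<open>p\<^sup>2\<close> times an expected increment of \<open>g\<close>. The increment from 0 to
  1 is absent because \<open>g 0\<close> occurs only with factor 0.\<close>

lemma bernoulli_sum_stein_bound:
  assumes "\<And>p. p \<in> set ps \<Longrightarrow> 0 \<le> p \<and> p \<le> 1"
    and "\<And>j. \<bar>g (j + 2) - g (j + 1)\<bar> \<le> c"
  shows "\<bar>bernoulli_sum_expectation ps (\<lambda>j. sum_list ps * g (j + 1) - real j * g j)\<bar>
           \<le> c * (\<Sum>p\<leftarrow>ps. p\<^sup>2)"
  using assms
proof (induction ps arbitrary: g)
  case (Cons p ps)
  let ?E = "bernoulli_sum_expectation ps"
  let ?L = "sum_list ps"
  let ?Q = "\<Sum>p\<leftarrow>ps. p\<^sup>2"
  have p: "0 \<le> p" "p \<le> 1" using Cons.prems(1) by auto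
  have A: "\<bar>?E (\<lambda>j. ?L * g (j + 1) - real j * g j)\<bar> \<le> c * ?Q"
    using Cons.prems by (intro Cons.IH) auto
  have B: "\<bar>?E (\<lambda>j. ?L * g (Suc (j + 1)) - real j * g (Suc j))\<bar> \<le> c * ?Q"
  proof (rule Cons.IH[of "\<lambda>j. g (Suc j)"])
    show "\<bar>g (Suc (j + 2)) - g (Suc (j + 1))\<bar> \<le> c" for j
      using Cons.prems(2)[of "Suc j"] by simp
  qed (use Cons.prems(1) in auto)
  have C: "\<bar>?E (\<lambda>j. g (j + 2) - g (j + 1))\<bar> \<le> c"
    using Cons.prems by (intro bernoulli_sum_expectation_bound) auto
  have lin: "?E (\<lambda>j. x * f j - real j * h j) = x * ?E f - ?E (\<lambda>j. real j * h j)" for x f h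
    using bernoulli_sum_expectation_linear[of ps x f "-1" "\<lambda>j. real j * h j"] by simp
  have sub: "?E (\<lambda>j. f j - h j) = ?E f - ?E h" for f h
    using bernoulli_sum_expectation_linear[of ps 1 f "-1" h] by simp
  have add: "?E (\<lambda>j. f j + h j) = ?E f + ?E h" for f h
    using bernoulli_sum_expectation_linear[of ps 1 f 1 h] by simp
  have scale: "?E (\<lambda>j. x * f j) = x * ?E f" for x f
    using bernoulli_sum_expectation_linear[of ps x f 0 f] by simp
  \<comment> \<open>The shifted term \<open>(j + 1) * g (j + 1)\<close> exceeds
    \<open>j * g (j + 1)\<close> by \<open>g (j + 1)\<close>, so the leftover coefficient of
    \<open>g (j + 1)\<close> is \<open>p * (1 - p) - p\<close>, which is
    \<open>- p\<^sup>2\<close>.\<close>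
  have "bernoulli_sum_expectation (p # ps) (\<lambda>j. sum_list (p # ps) * g (j + 1) - real j * g j) =
      ((1 - p) * ?E (\<lambda>j. ?L * g (j + 1) - real j * g j)
       + p * ?E (\<lambda>j. ?L * g (Suc (j + 1)) - real j * g (Suc j)))
       + p\<^sup>2 * ?E (\<lambda>j. g (j + 2) - g (j + 1))"
    by (simp add: lin sub add scale algebra_simps power2_eq_square)
  also have "\<bar>\<dots>\<bar> \<le> c * ?Q + p\<^sup>2 * c"
  proof (rule order_trans[OF abs_triangle_ineq add_mono])
    show "\<bar>p\<^sup>2 * ?E (\<lambda>j. g (j + 2) - g (j + 1))\<bar> \<le> p\<^sup>2 * c"
      using C by (simp add: abs_mult mult_left_mono)
  qed (rule abs_convex_combination_le[OF p A B])
  finally show ?case by (simp add: algebra_simps)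
qed simp

section \<open>The law of the depth of a label\<close>

text \<open>The latest attachment comes first, so that one more attachment is a \<open>Cons\<close>,
  matching the recursion of \<open>bernoulli_sum_expectation\<close>.\<close>

definition attachment_probs :: "nat \<Rightarrow> nat \<Rightarrow> real list" where
  "attachment_probs m k = rev (map (\<lambda>i. 1 / (real (Suc i) + 1 / real m)) [0..<k])"

lemma attachment_probs_Suc:
  "attachment_probs m (Suc k) = 1 / (real (Suc k) + 1 / real m) # attachment_probs m k"
  by (simp add: attachment_probs_def)

text \<open>All trees in the support have \<open>m * k + 1\<close> nodes, so the average over a
  uniform node has the same denominator for each of them.\<close>

lemma expectation_bind_recursive_tree:
  shows "measure_pmf.expectation
      (bind_pmf (recursive_tree m k) (\<lambda>t. map_pmf (F t) (pmf_of_set (nodes t)))) (G :: 'a \<Rightarrow> real) =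
    measure_pmf.expectation (recursive_tree m k) (\<lambda>t. (\<Sum>v\<in>nodes t. G (F t v)) / (real m * real k + 1))"
proof -
  have fin: "finite (set_pmf (map_pmf (F t) (pmf_of_set (nodes t))))"
    if "t \<in> set_pmf (recursive_tree m k)" for t
    using card_nodes(1,2)[OF that] by (simp add: set_pmf_of_set)
  have "measure_pmf.expectation
      (bind_pmf (recursive_tree m k) (\<lambda>t. map_pmf (F t) (pmf_of_set (nodes t)))) G =
    (\<Sum>t\<in>set_pmf (recursive_tree m k). pmf (recursive_tree m k) t *\<^sub>R
       measure_pmf.expectation (map_pmf (F t) (pmf_of_set (nodes t))) G)"
    using fin by (intro pmf_expectation_bind finite_set_recursive_tree) auto
  also have "\<dots> = measure_pmf.expectation (recursive_tree m k)
      (\<lambda>t. measure_pmf.expectation (map_pmf (F t) (pmf_of_set (nodes t))) G)"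
    by (subst integral_measure_pmf[OF finite_set_recursive_tree]) (auto simp: mult.commute)
  also have "\<dots> = measure_pmf.expectation (recursive_tree m k)
      (\<lambda>t. (\<Sum>v\<in>nodes t. G (F t v)) / (real m * real k + 1))"
    using card_nodes
    by (intro integral_cong_AE AE_pmfI) (simp_all add: integral_pmf_of_set)
  finally show ?thesis .
qed

text \<open>
  The \<open>m\<close> new nodes make up the fraction \<open>m / (m (k + 1) + 1) = 1 / (k + 1 + 1 / m)\<close> of the
  enlarged tree, and each of them lies one level below a uniform node of the old tree.
\<close>

lemma expectation_uniform_node_depth:
  assumes "m \<ge> 1"
  shows "measure_pmf.expectation (recursive_tree m k)
      (\<lambda>t. (\<Sum>v\<in>nodes t. f (depth t v)) / (real m * real k + 1)) =
    bernoulli_sum_expectation (attachment_probs m k) f"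
proof (induction k arbitrary: f)
  case 0
  have "depth root_tree root_node = 0"
    using recursive_tree_height(1)[of root_tree m 0] by simp
  then show ?case by (simp add: attachment_probs_def root_tree_def)
next
  case (Suc k)
  let ?T = "recursive_tree m k" and ?N = "real m * real k + 1"
  let ?p = "1 / (real (Suc k) + 1 / real m)"
  let ?S = "\<lambda>f t. \<Sum>v\<in>nodes t. f (depth t v)"
  have N: "?N > 0" "real m * real (Suc k) + 1 > 0" by (auto intro: add_nonneg_pos)
  have int: "integrable (measure_pmf ?T) h" for h :: "tree \<Rightarrow> real"
    by (intro integrable_measure_pmf_finite finite_set_recursive_tree)
  have rec: "recursive_tree m (Suc k) =
      bind_pmf ?T (\<lambda>t. map_pmf (\<lambda>v. attach m (k + 2) v t) (pmf_of_set (nodes t)))"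
    by (simp add: map_pmf_def)
  have step: "?S f (attach m (k + 2) v s) = ?S f s + real m * f (Suc (depth s v))"
    if s: "s \<in> set_pmf ?T" and v: "v \<in> nodes s" for s v
  proof -
    let ?t = "attach m (k + 2) v s"
    have "?S f ?t = (\<Sum>w\<in>nodes s. f (depth ?t w)) + (\<Sum>w\<in>{k + 2} \<times> {..<m}. f (depth ?t w))"
      using card_nodes[OF s] by (simp add: attach_def sum.union_disjoint)
    also have "(\<Sum>w\<in>nodes s. f (depth ?t w)) = ?S f s"
      using depth_attach(1)[OF s v] by simp
    also have "(\<Sum>w\<in>{k + 2} \<times> {..<m}. f (depth ?t w)) =
        (\<Sum>w\<in>{k + 2} \<times> {..<m}. f (Suc (depth s v)))"
      by (rule sum.cong[OF refl]) (use depth_attach(2)[OF s v] in auto)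
    finally show ?thesis by (simp add: card_cartesian_product)
  qed
  have "measure_pmf.expectation (recursive_tree m (Suc k))
      (\<lambda>t. ?S f t / (real m * real (Suc k) + 1)) =
    measure_pmf.expectation ?T (\<lambda>s.
      (\<Sum>v\<in>nodes s. ?S f (attach m (k + 2) v s) / (real m * real (Suc k) + 1)) / ?N)"
    unfolding rec by (rule expectation_bind_recursive_tree)
  also have "\<dots> = measure_pmf.expectation ?T (\<lambda>s.
      (1 - ?p) * (?S f s / ?N) + ?p * (?S (\<lambda>j. f (Suc j)) s / ?N))"
  proof (intro integral_cong_AE AE_pmfI)
    fix s assume s: "s \<in> set_pmf ?T"
    have "(\<Sum>v\<in>nodes s. ?S f (attach m (k + 2) v s) / (real m * real (Suc k) + 1)) / ?N =
      (\<Sum>v\<in>nodes s. (?S f s + real m * f (Suc (depth s v)))) / (real m * real (Suc k) + 1) / ?N"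
      using step[OF s] by (simp add: sum_divide_distrib)
    \<comment> \<open>The first summand does not depend on \<open>v\<close>, so summing over
      \<open>v\<close> multiplies it by the node count \<open>m * k + 1\<close>.\<close>
    also have "\<dots> = (?N * ?S f s + real m * ?S (\<lambda>j. f (Suc j)) s) / (real m * real (Suc k) + 1) / ?N"
      using card_nodes(3)[OF s] by (simp add: sum.distrib sum_distrib_left[symmetric] algebra_simps)
    also have "\<dots> = (?N / (real m * real (Suc k) + 1)) * (?S f s / ?N) +
       (real m / (real m * real (Suc k) + 1)) * (?S (\<lambda>j. f (Suc j)) s / ?N)"
    proof -
      have "(x * a + c * b) / y / x = (x / y) * (a / x) + (c / y) * (b / x)"
        if "x > 0" "y > 0" for x y a b c :: real
        using that by (simp add: field_simps)
      then show ?thesis using N by blast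
    qed
    also have "real m / (real m * real (Suc k) + 1) = ?p"
      using assms N by (simp add: field_simps)
    also have "?N / (real m * real (Suc k) + 1) = 1 - ?p"
    proof -
      have "?p = real m / (real m * real (Suc k) + 1)"
        using assms N by (simp add: field_simps)
      then show ?thesis using N(2) by (simp add: field_simps)
    qed
    finally show "(\<Sum>v\<in>nodes s. ?S f (attach m (k + 2) v s) / (real m * real (Suc k) + 1)) / ?N =
      (1 - ?p) * (?S f s / ?N) + ?p * (?S (\<lambda>j. f (Suc j)) s / ?N)" .
  qed simp_all
  also have "\<dots> = (1 - ?p) * measure_pmf.expectation ?T (\<lambda>s. ?S f s / ?N)
      + ?p * measure_pmf.expectation ?T (\<lambda>s. ?S (\<lambda>j. f (Suc j)) s / ?N)"
    by (subst Bochner_Integration.integral_add[OF int int])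
       (simp only: integral_mult_right_zero)
  also have "\<dots> = bernoulli_sum_expectation (attachment_probs m (Suc k)) f"
    by (simp only: Suc.IH[of f] Suc.IH[of "\<lambda>j. f (Suc j)"] attachment_probs_Suc
        bernoulli_sum_expectation.simps)
  finally show ?case .
qed

text \<open>The parent of the nodes labeled \<open>n\<close> is a uniform node of the tree after
  \<open>n - 2\<close> attachments. The leading parameter 1, a variable that always equals 1, counts
  the edge from that parent.\<close>

lemma expectation_D_law:
  assumes "m \<ge> 1" "n \<ge> 2"
  shows "measure_pmf.expectation (D_law m n) f =
    bernoulli_sum_expectation (1 # attachment_probs m (n - 2)) f"
proof -
  define k where "k = n - 2"
  have n: "n = k + 2" using assms(2) by (simp add: k_def)
  let ?T = "recursive_tree m k"
  have "D_law m n = bind_pmf ?T (\<lambda>s. map_pmf (\<lambda>v. label_depth n (attach m n v s)) (pmf_of_set (nodes s)))"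
    by (simp add: D_law_def n map_bind_pmf map_pmf_def bind_assoc_pmf bind_return_pmf)
  also have "\<dots> = bind_pmf ?T (\<lambda>s. map_pmf (\<lambda>v. Suc (depth s v)) (pmf_of_set (nodes s)))"
  proof (intro bind_pmf_cong map_pmf_cong refl)
    fix s v assume s: "s \<in> set_pmf ?T" and v': "v \<in> set_pmf (pmf_of_set (nodes s))"
    then have v: "v \<in> nodes s" using card_nodes[OF s] by simp
    let ?t = "attach m n v s"
    have t: "?t \<in> set_pmf (recursive_tree m (Suc k))"
      using s v' by (auto simp: n)
    \<comment> \<open>Index 0 occurs since \<open>m \<ge> 1\<close>, and it represents its label
      because all nodes of one label share a depth.\<close>
    have "depth ?t (n, 0) \<in> depth ?t ` {w \<in> nodes ?t. label w = n}"
      using assms by (intro imageI) (auto simp: attach_def)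
    then have "depth ?t (n, 0) = label_depth n ?t"
      using depths_singleton[OF t assms(1), of n] by (simp add: n)
    then show "label_depth n ?t = Suc (depth s v)"
      using depth_attach(2)[OF s v, of 0] assms by (simp add: n)
  qed
  finally have "measure_pmf.expectation (D_law m n) f =
     measure_pmf.expectation ?T (\<lambda>t. (\<Sum>v\<in>nodes t. f (Suc (depth t v))) / (real m * real k + 1))"
    by (simp only: expectation_bind_recursive_tree)
  also have "\<dots> = bernoulli_sum_expectation (attachment_probs m k) (\<lambda>j. f (Suc j))"
    by (rule expectation_uniform_node_depth[OF assms(1)])
  finally show ?thesis by (simp add: k_def)
qed

section \<open>The Stein equation of the Poisson law\<close>

context
  fixes \<mu> :: real and \<pi> :: "nat \<Rightarrow> real" and P :: "nat set \<Rightarrow> real"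
  assumes rate: "\<mu> > 0"
  defines "\<pi> \<equiv> pmf (poisson_pmf \<mu>)" and "P \<equiv> measure_pmf.prob (poisson_pmf \<mu>)"
begin

lemma poisson_pos: "\<pi> j > 0"
  using rate by (simp add: \<pi>_def)

text \<open>This relation between consecutive weights drives the Stein equation and both tail
  comparisons.\<close>

lemma poisson_Suc: "real (Suc j) * \<pi> (Suc j) = \<mu> * \<pi> j"
  using rate by (simp add: \<pi>_def divide_simps del: of_nat_Suc)

text \<open>For \<open>i < j\<close>, the weight \<open>\<mu> * \<pi> i\<close> equals
  \<open>(i + 1) * \<pi> (i + 1)\<close> with \<open>i + 1 \<le> j\<close>. The inequality makes the
  coefficient of the mass above \<open>j\<close> nonpositive in the increment bound.\<close>

lemma poisson_lessThan: "\<mu> * P {..<j} \<le> real j * P {..j}"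
proof -
  have "\<mu> * P {..<j} = (\<Sum>i<j. real (Suc i) * \<pi> (Suc i))"
    by (simp add: P_def measure_measure_pmf_finite sum_distrib_left poisson_Suc del: of_nat_Suc flip: \<pi>_def)
  also have "\<dots> \<le> (\<Sum>i<j. real j * \<pi> (Suc i))"
    using poisson_pos by (intro sum_mono mult_right_mono) (auto intro: less_imp_le)
  also have "\<dots> \<le> real j * (\<Sum>i<Suc j. \<pi> i)"
    unfolding sum.lessThan_Suc_shift using poisson_pos[of 0]
    by (simp add: sum_distrib_left[symmetric] mult_left_mono)
  finally show ?thesis
    by (simp add: P_def measure_measure_pmf_finite lessThan_Suc_atMost flip: \<pi>_def)
qed

lemma poisson_tail_sums: "(\<lambda>i. \<pi> (i + j)) sums P {j..}"
proof -
  have "(\<lambda>i. P {i + j}) sums P (\<Union>i. {i + j})"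
    unfolding P_def
    by (rule measure_pmf.finite_measure_UNION) (auto simp: disjoint_family_on_def)
  moreover have "(\<Union>i. {i + j}) = {j..}"
    by (auto simp: image_iff) presburger
  ultimately show ?thesis
    by (simp add: P_def \<pi>_def measure_pmf_single)
qed

text \<open>Mirror image of \<open>poisson_lessThan\<close>: in the upper tail the factor is at
  least \<open>j\<close>, and the series are compared termwise. This settles the sign of the
  coefficient of the mass below \<open>j\<close>.\<close>

lemma poisson_greaterThan: "real j * P {j<..} \<le> \<mu> * P {j..}"
proof -
  have "P {j<..} = P {Suc j..}" by (simp add: atLeast_Suc_greaterThan)
  then have lower: "(\<lambda>i. real j * \<pi> (i + Suc j)) sums (real j * P {j<..})"
    using poisson_tail_sums[of "Suc j"] by (simp only: sums_mult)
  have upper: "(\<lambda>i. \<mu> * \<pi> (i + j)) sums (\<mu> * P {j..})"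
    by (intro sums_mult poisson_tail_sums)
  have "real j * \<pi> (i + Suc j) \<le> \<mu> * \<pi> (i + j)" for i
  proof -
    have "real j * \<pi> (i + Suc j) \<le> real (Suc (i + j)) * \<pi> (Suc (i + j))"
      using poisson_pos[of "Suc (i + j)"] by (simp add: mult_right_mono)
    then show ?thesis by (simp only: poisson_Suc)
  qed
  then show ?thesis by (rule sums_le[OF _ lower upper])
qed

text \<open>Obtained by solving the Stein equation forward from 0 with the weights
  \<open>\<pi>\<close>. The equation multiplies the value at 0 by 0, which leaves that value free; 0
  is chosen.\<close>

definition stein_solution :: "nat set \<Rightarrow> nat \<Rightarrow> real" where
  "stein_solution A j = (if j = 0 then 0
     else (P (A \<inter> {..<j}) - P A * P {..<j}) / (real j * \<pi> j))"

text \<open>The numerator grows by \<open>\<pi> j * (indicat_real A j - P A)\<close> from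
  \<open>j\<close> to \<open>j + 1\<close>, and \<open>poisson_Suc\<close> brings both terms over
  the denominator \<open>\<pi> j\<close>.\<close>

lemma stein_equation:
  "\<mu> * stein_solution A (j + 1) - real j * stein_solution A j = indicat_real A j - P A"
proof -
  \<comment> \<open>The cases \<open>A\<close> and \<open>UNIV\<close> give the growth of the two
    terms of the numerator.\<close>
  have *: "P (B \<inter> {..<Suc j}) = P (B \<inter> {..<j}) + indicat_real B j * \<pi> j" for B
  proof -
    have "P (B \<inter> {..<Suc j}) = P ((B \<inter> {..<j}) \<union> (B \<inter> {j}))"
      by (rule arg_cong[of _ _ P]) auto
    also have "\<dots> = P (B \<inter> {..<j}) + P (B \<inter> {j})"
      unfolding P_def by (intro measure_pmf.finite_measure_Union) auto
    also have "P (B \<inter> {j}) = indicat_real B j * \<pi> j"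
      by (cases "j \<in> B") (simp_all add: P_def \<pi>_def measure_pmf_single)
    finally show ?thesis .
  qed
  have "\<mu> * stein_solution A (j + 1) =
     (P (A \<inter> {..<Suc j}) - P A * P {..<Suc j}) / \<pi> j"
    using rate poisson_Suc[of j] by (simp add: stein_solution_def)
  also have "\<dots> = (P (A \<inter> {..<j}) - P A * P {..<j}) / \<pi> j + (indicat_real A j - P A)"
    using *[of A] *[of UNIV] poisson_pos[of j] by (simp add: field_simps)
  \<comment> \<open>At \<open>j = 0\<close> both sides are 0, since no mass lies below 0.\<close>
  also have "(P (A \<inter> {..<j}) - P A * P {..<j}) / \<pi> j = real j * stein_solution A j"
    by (simp add: stein_solution_def P_def)
  finally show ?thesis by simp
qed

text \<open>The numerator is additive in \<open>A\<close> and vanishes for \<open>UNIV\<close>.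
  Passing to the complement turns the one-sided increment bound into a two-sided one.\<close>

lemma stein_solution_Compl: "stein_solution (- A) j = - stein_solution A j"
proof -
  have "P (- A \<inter> {..<j}) = P {..<j} - P (A \<inter> {..<j})"
    unfolding P_def by (subst measure_pmf.finite_measure_Diff[symmetric])
      (auto intro: arg_cong[of _ _ "measure_pmf.prob _"])
  moreover have "P (- A) = 1 - P A"
    unfolding P_def using measure_pmf.prob_compl[of A] by (simp add: Compl_eq_Diff_UNIV)
  ultimately have "P (- A \<inter> {..<j}) - P (- A) * P {..<j} =
      P {..<j} - P (A \<inter> {..<j}) - (1 - P A) * P {..<j}"
    by (simp only:)
  then have "P (- A \<inter> {..<j}) - P (- A) * P {..<j} = - (P (A \<inter> {..<j}) - P A * P {..<j})"
    by (simp add: left_diff_distrib)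
  then show ?thesis
    by (simp add: stein_solution_def minus_divide_left)
qed

text \<open>
  The increment is linear in the masses that \<open>A\<close> puts below, at and above \<open>j\<close>; the first and
  the last of these have nonpositive coefficients.
\<close>

lemma stein_solution_increment_le:
  assumes "j > 0"
  shows "stein_solution A (j + 1) - stein_solution A j \<le> 1 / \<mu>"
proof -
  define a where "a = P (A \<inter> {..<j})"
  define b where "b = P (A \<inter> {j})"
  define c where "c = P (A \<inter> {j<..})"
  define F where "F = P {..<j}"
  define q where "q = \<pi> j"
  define T where "T = P {j<..}"
  have add: "P (X \<union> Y) = P X + P Y" if "X \<inter> Y = {}" for X Y
    unfolding P_def using that by (intro measure_pmf.finite_measure_Union) auto
  have q: "P {j} = q" "q > 0"
    using poisson_pos[of j] by (simp_all add: P_def \<pi>_def q_def measure_pmf_single)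
  have A1: "P (A \<inter> {..<Suc j}) = a + b"
    unfolding a_def b_def by (subst add[symmetric]) (auto intro: arg_cong[of _ _ P])
  have A2: "P A = a + b + c"
    unfolding A1[symmetric] c_def by (subst add[symmetric]) (auto intro: arg_cong[of _ _ P])
  have F1: "P {..<Suc j} = F + q"
    unfolding F_def q(1)[symmetric] by (subst add[symmetric]) (auto intro: arg_cong[of _ _ P])
  have "P UNIV = F + q + T"
    unfolding F1[symmetric] T_def by (subst add[symmetric]) (auto intro: arg_cong[of _ _ P])
  then have T: "T = 1 - F - q" by (simp add: P_def)
  have G: "P {j..} = q + T"
    unfolding T_def q(1)[symmetric] by (subst add[symmetric]) (auto intro: arg_cong[of _ _ P])
  have pos: "a \<ge> 0" "b \<ge> 0" "c \<ge> 0" "F \<ge> 0" "T \<ge> 0"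
    by (simp_all add: a_def b_def c_def F_def T_def P_def)
  have "b \<le> q"
    unfolding b_def q(1)[symmetric] P_def by (intro measure_pmf.finite_measure_mono) auto
  have I1: "real j * T \<le> \<mu> * (q + T)"
    using poisson_greaterThan[of j] by (simp add: T_def G[unfolded T_def])
  have I2: "\<mu> * F \<le> real j * (F + q)"
    using poisson_lessThan[of j] F1 by (simp add: F_def lessThan_Suc_atMost)
  have "stein_solution A (j + 1) = ((a + b) - (a + b + c) * (F + q)) / (\<mu> * q)"
    using poisson_Suc[of j] by (simp add: stein_solution_def A1 A2 F1 q_def)
  moreover have "stein_solution A j = (a - (a + b + c) * F) / (real j * q)"
    using assms by (simp add: stein_solution_def A2 a_def[symmetric] F_def q_def)
  moreover have "x / (\<mu> * q) - y / (real j * q) = (real j * x - \<mu> * y) / (\<mu> * real j * q)" for x y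
    using rate assms q(2) by (simp add: field_simps)
  ultimately have "stein_solution A (j + 1) - stein_solution A j =
     (real j * ((a + b) - (a + b + c) * (F + q)) - \<mu> * (a - (a + b + c) * F)) / (\<mu> * real j * q)"
    by simp
  also have "\<dots> \<le> (real j * q) / (\<mu> * real j * q)"
  proof (rule divide_right_mono)
    have "real j * ((a + b) - (a + b + c) * (F + q)) - \<mu> * (a - (a + b + c) * F) =
      a * (real j * T - \<mu> * (q + T)) + b * (real j * T + \<mu> * F) + c * (\<mu> * F - real j * (F + q))"
      unfolding T by (simp add: algebra_simps)
    \<comment> \<open>\<open>I1\<close> and \<open>I2\<close> remove the outer terms. In the middle
      one \<open>b \<le> q\<close>, and \<open>I2\<close> bounds \<open>j * T + \<mu> * F\<close> by
      \<open>j * (T + F + q)\<close>, which is \<open>j\<close>.\<close>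
    also have "\<dots> \<le> 0 + q * (real j * 1) + 0"
    proof (intro add_mono mult_mono)
      show "a * (real j * T - \<mu> * (q + T)) \<le> 0"
        using pos I1 by (simp add: mult_nonneg_nonpos)
      show "c * (\<mu> * F - real j * (F + q)) \<le> 0"
        using pos I2 by (simp add: mult_nonneg_nonpos)
      show "real j * T + \<mu> * F \<le> real j * 1"
        using I2 unfolding T by (simp add: algebra_simps)
    qed (use pos \<open>b \<le> q\<close> rate q in auto)
    finally show "real j * ((a + b) - (a + b + c) * (F + q)) - \<mu> * (a - (a + b + c) * F) \<le> real j * q"
      by (simp add: mult.commute)
  qed (use rate q in auto)
  also have "\<dots> = 1 / \<mu>" using assms q by simp
  finally show ?thesis .
qed

lemma stein_solution_increment:
  assumes "j > 0"
  shows "\<bar>stein_solution A (j + 1) - stein_solution A j\<bar> \<le> 1 / \<mu>"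
  using stein_solution_increment_le[OF assms, of A] stein_solution_increment_le[OF assms, of "- A"]
  unfolding stein_solution_Compl by linarith

end

section \<open>From the Stein equation to total variation\<close>

text \<open>Averaging the Stein equation for \<open>A\<close> under \<open>W\<close> turns the
  difference of probabilities into the expression that \<open>bernoulli_sum_stein_bound\<close>
  controls, with the reciprocal of the mean as increment bound.\<close>

theorem dTV_poisson_le:
  assumes W: "\<And>A. measure_pmf.prob W A = bernoulli_sum_expectation ps (indicat_real A)"
    and ps: "\<And>p. p \<in> set ps \<Longrightarrow> 0 \<le> p \<and> p \<le> 1" and "sum_list ps > 0"
  shows "dTV W (poisson_pmf (sum_list ps)) \<le> (\<Sum>p\<leftarrow>ps. p\<^sup>2) / sum_list ps"
  unfolding dTV_def
proof (rule cSUP_least)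
  fix A :: "nat set"
  let ?\<mu> = "sum_list ps"
  let ?g = "stein_solution ?\<mu> A" and ?P = "measure_pmf.prob (poisson_pmf ?\<mu>) A"
  note rate = \<open>?\<mu> > 0\<close>
  have "bernoulli_sum_expectation ps (\<lambda>j. ?\<mu> * ?g (j + 1) - real j * ?g j) =
      bernoulli_sum_expectation ps (\<lambda>j. indicat_real A j - ?P)"
    by (simp only: stein_equation[OF rate])
  also have "\<dots> = measure_pmf.prob W A - ?P"
    using bernoulli_sum_expectation_linear[of ps 1 "indicat_real A" "-1" "\<lambda>_. ?P"] by (simp add: W)
  finally have eq: "measure_pmf.prob W A - ?P =
      bernoulli_sum_expectation ps (\<lambda>j. ?\<mu> * ?g (j + 1) - real j * ?g j)" ..
  have "\<bar>measure_pmf.prob W A - ?P\<bar> \<le> (1 / ?\<mu>) * (\<Sum>p\<leftarrow>ps. p\<^sup>2)"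
    unfolding eq
  proof (rule bernoulli_sum_stein_bound[OF ps])
    \<comment> \<open>Only arguments from 1 on occur, which is the range of
      \<open>stein_solution_increment\<close>.\<close>
    show "\<bar>?g (j + 2) - ?g (j + 1)\<bar> \<le> 1 / ?\<mu>" for j
      using stein_solution_increment[OF rate, of "j + 1" A] by simp
  qed
  then show "\<bar>measure_pmf.prob W A - ?P\<bar> \<le> (\<Sum>p\<leftarrow>ps. p\<^sup>2) / ?\<mu>" by simp
qed simp

section \<open>Harmonic sums, the trigamma function and the final bounds\<close>

text \<open>Exponent 1 serves for the Poisson mean, exponent 2 for the error term.\<close>

lemma sum_list_attachment_probs:
  "(\<Sum>p\<leftarrow>attachment_probs m k. p ^ r) = shifted_harm r k (1 / real m)"
proof (induction k)
  case 0
  show ?case by (simp add: attachment_probs_def shifted_harm_def)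
next
  case (Suc k)
  then show ?case by (simp add: attachment_probs_Suc shifted_harm_def power_one_over)
qed

lemma shifted_harm_2_le_Polygamma:
  assumes "y > 0"
  shows "shifted_harm 2 k y \<le> Polygamma 1 (1 + y)"
proof -
  have "shifted_harm 2 k y = (\<Sum>i<k. inverse ((1 + y + real i) ^ Suc 1))"
    unfolding shifted_harm_def
    by (rule sum.reindex_bij_witness[of _ Suc "\<lambda>i. i - 1"])
       (auto simp: field_simps power2_eq_square)
  also have "\<dots> \<le> (\<Sum>i. inverse ((1 + y + real i) ^ Suc 1))"
  proof (rule sum_le_suminf)
    show "summable (\<lambda>i. inverse ((1 + y + real i) ^ Suc 1))"
      using assms by (intro Polygamma_converges') auto
  qed (use assms in auto)
  \<comment> \<open>At order 1 the sign and the factorial in \<open>Polygamma_def\<close> are both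
    1.\<close>
  also have "\<dots> = Polygamma 1 (1 + y)"
    by (simp add: Polygamma_def)
  finally show ?thesis .
qed

text \<open>Compare \<open>ln (k + 2)\<close> with \<open>harm (k + 1)\<close>: its first term is
  the 1, and each later term \<open>1 / (i + 1)\<close> is at most \<open>1 / (i + y)\<close>
  because \<open>y \<le> 1\<close>.\<close>

lemma ln_le_shifted_harm:
  assumes "0 < y" "y \<le> 1" "n \<ge> 2"
  shows "ln (real n) \<le> 1 + shifted_harm 1 (n - 2) y"
proof -
  define k where "k = n - 2"
  have n: "n = k + 2" using assms(3) by (simp add: k_def)
  have "ln (real n) \<le> harm (Suc k)"
    using ln_le_harm[of "Suc k"] by (simp add: n)
  also have "harm (Suc k) = 1 + (\<Sum>i=1..k. 1 / (real i + 1))"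
  proof (induction k)
    case (Suc k)
    then show ?case
      by (simp add: harm_Suc[of "Suc k"] inverse_eq_divide add_ac)
  qed (simp add: harm_expand)
  also have "\<dots> \<le> 1 + shifted_harm 1 k y"
    unfolding shifted_harm_def using assms
    by (intro add_left_mono sum_mono) (auto intro!: divide_left_mono add_pos_pos mult_pos_pos)
  finally show ?thesis by (simp add: k_def)
qed

theorem mainTheorem3:
  fixes m :: nat
  assumes "m \<ge> 1"
  shows "(\<forall>n\<ge>2.
            dTV (D_law m n) (poisson_pmf (1 + shifted_harm 1 (n - 2) (1 / real m)))
              \<le> (1 + Polygamma 1 (1 + 1 / real m)) / (1 + shifted_harm 1 (n - 2) (1 / real m)))
       \<and> (\<lambda>n. (1 + Polygamma 1 (1 + 1 / real m)) / (1 + shifted_harm 1 (n - 2) (1 / real m)))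
           \<in> O(\<lambda>n. 1 / ln (real n))"
proof (intro conjI allI impI)
  let ?y = "1 / real m"
  let ?c = "1 + Polygamma 1 (1 + ?y)"
  have y: "0 < ?y" "?y \<le> 1" using assms by auto
  have H: "shifted_harm 1 k ?y \<ge> 0" for k
    unfolding shifted_harm_def by (intro sum_nonneg) auto
  fix n :: nat assume n: "n \<ge> 2"
  let ?ps = "1 # attachment_probs m (n - 2)"
  have L: "sum_list ?ps = 1 + shifted_harm 1 (n - 2) ?y"
    using sum_list_attachment_probs[of 1 m "n - 2"] by simp
  have "dTV (D_law m n) (poisson_pmf (sum_list ?ps)) \<le> (\<Sum>p\<leftarrow>?ps. p\<^sup>2) / sum_list ?ps"
  proof (rule dTV_poisson_le)
    show "measure_pmf.prob (D_law m n) A = bernoulli_sum_expectation ?ps (indicat_real A)" for A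
      using expectation_D_law[OF assms n, of "indicat_real A"] by simp
    show "0 \<le> p \<and> p \<le> 1" if "p \<in> set ?ps" for p
    proof -
      have "1 \<le> real (Suc i) + ?y" for i by simp
      then have "0 \<le> 1 / (real (Suc i) + ?y) \<and> 1 / (real (Suc i) + ?y) \<le> 1" for i
        by (smt (verit) divide_le_eq_1_pos divide_nonneg_nonneg)
      then show ?thesis using that by (auto simp: attachment_probs_def simp del: of_nat_Suc)
    qed
    show "sum_list ?ps > 0" using H[of "n - 2"] unfolding L by simp
  qed
  \<comment> \<open>The leading parameter contributes the 1, the others a partial sum of the
    trigamma series.\<close>
  also have "(\<Sum>p\<leftarrow>?ps. p\<^sup>2) \<le> ?c"
    using shifted_harm_2_le_Polygamma[OF y(1)] by (simp add: sum_list_attachment_probs)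
  finally show "dTV (D_law m n) (poisson_pmf (1 + shifted_harm 1 (n - 2) ?y))
      \<le> ?c / (1 + shifted_harm 1 (n - 2) ?y)"
    using H[of "n - 2"] unfolding L by (simp add: divide_right_mono)
next
  let ?y = "1 / real m"
  let ?c = "1 + Polygamma 1 (1 + ?y)"
  have y: "0 < ?y" "?y \<le> 1" using assms by auto
  \<comment> \<open>The empty partial sum shows that the trigamma value is nonnegative.\<close>
  have c: "?c \<ge> 0"
    using shifted_harm_2_le_Polygamma[OF y(1), of 0] by (simp add: shifted_harm_def)
  show "(\<lambda>n. ?c / (1 + shifted_harm 1 (n - 2) ?y)) \<in> O(\<lambda>n. 1 / ln (real n))"
  \<comment> \<open>The numerator itself serves as the constant, since the denominator is at least
    \<open>ln n\<close>; from 2 on the logarithm is positive.\<close>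
  proof (intro bigoI[of _ ?c] eventually_mono[OF eventually_ge_at_top[of 2]])
    fix n :: nat assume "n \<ge> 2"
    then have "0 < ln (real n)" "ln (real n) \<le> 1 + shifted_harm 1 (n - 2) ?y"
      using ln_le_shifted_harm[OF y] by auto
    then show "norm (?c / (1 + shifted_harm 1 (n - 2) ?y)) \<le> ?c * norm (1 / ln (real n))"
      using c by (simp add: frac_le)
  qed
qed

end
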